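(* Let $F$ be a field, $A\in F^{n\times n}$ and $\lambda\in F$. Then $\{\overline{B}\mid B\in C_F(A,\lambda)\}$ equals the row null space $\{w\in F^{n^2}\mid wH=0\}$ of the $n^2\times n^2$ matrix $$H=A^t\otimes I_n-\lambda I_n\otimes A.$$
   Context: For a field $F$, $A\in F^{n\times n}$ and $\lambda\in F$, $C_F(A,\lambda)=\{B\in F^{n\times n}\mid AB-\lambda BA=0\}$. For $B=(b_{ij})\in F^{n\times n}$, $\overline{B}$ denotes the $1\times n^2$ row vector obtained by concatenating the rows of $B$: its $k$th entry is $b_{ij}$ where $i=\lceil k/n\rceil$ and $j=k-(i-1)n$. $A^t$ is the transpose of $A$, $I_n$ is the identity matrix, and $\otimes$ is the Kronecker product, with the convention that the entry of $X\otimes Y$ (for $X,Y\in F^{n\times n}$) in row $(i-1)n+j$ and column $(i'-1)n+j'$ is $X_{ii'}Y_{jj'}$. *)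

theory Defs
  imports "Jordan_Normal_Form.Matrix"
begin

definition twisted_centralizer :: "nat \<Rightarrow> 'a :: field mat \<Rightarrow> 'a \<Rightarrow> 'a mat set" where
  "twisted_centralizer n A lam =
     {B \<in> carrier_mat n n. A * B - lam \<cdot>\<^sub>m (B * A) = 0\<^sub>m n n}"

(* Rows of B laid side by side. The 1-based entry number k, in row i = ceiling (k/n) and
   column j = k - (i-1)n, has 0-based position (k' div n, k' mod n) for k' = k - 1. *)
definition row_concat :: "'a mat \<Rightarrow> 'a mat" where
  "row_concat B = mat 1 (dim_row B * dim_col B)
     (\<lambda>(_, k). B $$ (k div dim_col B, k mod dim_col B))"

(* The 1-based row (i-1)n+j and column (i'-1)n+j' become, 0-based, i*n+j and i'*n+j',
   so that div and mod recover the row and column indices of X and of Y. *)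
definition kronecker :: "'a :: times mat \<Rightarrow> 'a mat \<Rightarrow> 'a mat" where
  "kronecker X Y = mat (dim_row X * dim_row Y) (dim_col X * dim_col Y)
     (\<lambda>(r, c). X $$ (r div dim_row Y, c div dim_col Y) * Y $$ (r mod dim_row Y, c mod dim_col Y))"

definition row_null_space :: "'a :: semiring_0 mat \<Rightarrow> 'a mat set" where
  "row_null_space H = {w \<in> carrier_mat 1 (dim_row H). w * H = 0\<^sub>m 1 (dim_col H)}"

end

theory Submission
  imports Defs
begin

text \<open>
  The proof rests on the vectorisation identity: laying the rows of a matrix side by side
  turns the two-sided product \<open>X\<^sup>t B Y\<close> into right multiplication of the row vector of \<open>B\<close> by
  the Kronecker product of \<open>X\<close> and \<open>Y\<close> (\<open>row_concat_mult_kronecker\<close>). With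
  \<open>X = A\<^sup>t\<close>, \<open>Y = I\<close> it represents left multiplication of \<open>B\<close> by \<open>A\<close>, and with
  \<open>X = I\<close>, \<open>Y = A\<close> right multiplication. By linearity the matrix \<open>H\<close> therefore represents
  the map sending \<open>B\<close> to \<open>AB - \<lambda>BA\<close>, whose kernel is the twisted centralizer. Since
  concatenation of rows is a bijection from the \<open>n \<times> n\<close> matrices onto the row vectors of
  length \<open>n\<^sup>2\<close> that reflects zero (\<open>row_concat_surj\<close>, \<open>row_concat_eq_zero_iff\<close>), it carries
  this kernel onto the row null space of \<open>H\<close>.
\<close>

lemma row_concat_carrier:
  "B \<in> carrier_mat m p \<Longrightarrow> row_concat B \<in> carrier_mat 1 (m * p)"
  by (auto simp: row_concat_def)

lemma row_concat_index:
  assumes "B \<in> carrier_mat m p" and "k < m * p"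
  shows "row_concat B $$ (0, k) = B $$ (k div p, k mod p)"
  using assms by (auto simp: row_concat_def)

lemma kronecker_carrier [simp]:
  "X \<in> carrier_mat m q \<Longrightarrow> Y \<in> carrier_mat p r \<Longrightarrow> kronecker X Y \<in> carrier_mat (m * p) (q * r)"
  by (auto simp: kronecker_def)

lemma div_mod_less_of_less_mult:
  fixes c q r :: nat
  assumes "c < q * r"
  shows "c div r < q" and "c mod r < r"
  using assms by (cases "r = 0"; simp add: less_mult_imp_div_less)+

text \<open>Row-major enumeration of the index pairs of an \<open>m \<times> p\<close> matrix; this turns the single
  sum in a product with a row vector into a double sum.\<close>

lemma sum_row_major:
  fixes f :: "nat \<Rightarrow> nat \<Rightarrow> 'b :: comm_monoid_add"
  shows "(\<Sum>k<m * p. f (k div p) (k mod p)) = (\<Sum>i<m. \<Sum>j<p. f i j)"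
proof -
  have "(\<Sum>k<m * p. f (k div p) (k mod p))
      = (\<Sum>i<m. \<Sum>k = i * p..<i * p + p. f (k div p) (k mod p))"
    by (rule sum.nat_group [symmetric])
  also have "\<dots> = (\<Sum>i<m. \<Sum>j<p. f i j)"
  proof (rule sum.cong [OF refl])
    fix i
    have "(\<Sum>k = i * p..<i * p + p. f (k div p) (k mod p))
        = (\<Sum>j = 0..<p. f ((j + i * p) div p) ((j + i * p) mod p))"
      using sum.shift_bounds_nat_ivl [of "\<lambda>k. f (k div p) (k mod p)" 0 "i * p" p]
      by (simp add: add.commute)
    also have "\<dots> = (\<Sum>j<p. f i j)"
      by (rule sum.cong) auto
    finally show "(\<Sum>k = i * p..<i * p + p. f (k div p) (k mod p)) = (\<Sum>j<p. f i j)" .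
  qed
  finally show ?thesis .
qed

text \<open>In column \<open>(a, b)\<close> both sides are the sum of \<open>B\<^sub>i\<^sub>j X\<^sub>i\<^sub>a Y\<^sub>j\<^sub>b\<close> over all \<open>i\<close> and \<open>j\<close>; the factors
  are reordered, so the coefficients have to commute.\<close>

lemma row_concat_mult_kronecker:
  fixes B X Y :: "'a :: comm_semiring_0 mat"
  assumes B: "B \<in> carrier_mat m p" and X: "X \<in> carrier_mat m q" and Y: "Y \<in> carrier_mat p r"
  shows "row_concat B * kronecker X Y = row_concat (transpose_mat X * B * Y)"
proof (rule eq_matI)
  have P: "transpose_mat X * B * Y \<in> carrier_mat q r"
    using assms by auto
  show "dim_row (row_concat B * kronecker X Y) = dim_row (row_concat (transpose_mat X * B * Y))"
    by (simp add: row_concat_def)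
  show "dim_col (row_concat B * kronecker X Y) = dim_col (row_concat (transpose_mat X * B * Y))"
    using assms by (simp add: row_concat_def kronecker_def)
  fix l c
  assume "l < dim_row (row_concat (transpose_mat X * B * Y))"
    and "c < dim_col (row_concat (transpose_mat X * B * Y))"
  then have l: "l = 0" and c: "c < q * r"
    using row_concat_carrier [OF P] by auto
  define a where "a = c div r"
  define b where "b = c mod r"
  have a: "a < q" and b: "b < r"
    using div_mod_less_of_less_mult [OF c] by (auto simp: a_def b_def)
  have "(row_concat B * kronecker X Y) $$ (0, c)
      = (\<Sum>k<m * p. row_concat B $$ (0, k) * kronecker X Y $$ (k, c))"
    using c row_concat_carrier [OF B] kronecker_carrier [OF X Y]
    by (simp add: scalar_prod_def atLeast0LessThan)
  also have "\<dots> = (\<Sum>k<m * p. B $$ (k div p, k mod p) * (X $$ (k div p, a) * Y $$ (k mod p, b)))"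
    using c assms
    by (intro sum.cong refl) (simp add: row_concat_index [OF B] kronecker_def a_def b_def)
  also have "\<dots> = (\<Sum>i<m. \<Sum>j<p. B $$ (i, j) * (X $$ (i, a) * Y $$ (j, b)))"
    by (rule sum_row_major)
  also have "\<dots> = (\<Sum>j<p. (\<Sum>i<m. X $$ (i, a) * B $$ (i, j)) * Y $$ (j, b))"
    by (subst sum.swap) (simp add: sum_distrib_left sum_distrib_right ac_simps)
  also have "\<dots> = (transpose_mat X * B * Y) $$ (a, b)"
    using a b assms by (simp add: scalar_prod_def atLeast0LessThan del: assoc_mult_mat)
  also have "\<dots> = row_concat (transpose_mat X * B * Y) $$ (0, c)"
    using row_concat_index [OF P c] by (simp add: a_def b_def)
  finally show "(row_concat B * kronecker X Y) $$ (l, c)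
      = row_concat (transpose_mat X * B * Y) $$ (l, c)"
    using l by simp
qed

lemma row_concat_diff_smult:
  fixes C D :: "'a :: comm_ring_1 mat"
  assumes "C \<in> carrier_mat m p" and "D \<in> carrier_mat m p"
  shows "row_concat (C - s \<cdot>\<^sub>m D) = row_concat C - s \<cdot>\<^sub>m row_concat D"
  using assms by (intro eq_matI) (auto simp: row_concat_def div_mod_less_of_less_mult)

lemma row_concat_eq_zero_iff:
  assumes B: "B \<in> carrier_mat m p"
  shows "row_concat B = 0\<^sub>m 1 (m * p) \<longleftrightarrow> B = 0\<^sub>m m p"
proof
  assume z: "row_concat B = 0\<^sub>m 1 (m * p)"
  show "B = 0\<^sub>m m p"
  proof (rule eq_matI)
    fix i j
    assume "i < dim_row (0\<^sub>m m p :: 'a mat)" and "j < dim_col (0\<^sub>m m p :: 'a mat)"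
    then have i: "i < m" and j: "j < p"
      by auto
    have "i * p + j < Suc i * p"
      using j by simp
    also have "\<dots> \<le> m * p"
      using i by (intro mult_le_mono1) simp
    finally have k: "i * p + j < m * p" .
    show "B $$ (i, j) = 0\<^sub>m m p $$ (i, j)"
      using row_concat_index [OF B k] z i j k by simp
  qed (use B in auto)
next
  assume "B = 0\<^sub>m m p"
  then show "row_concat B = 0\<^sub>m 1 (m * p)"
    by (intro eq_matI) (auto simp: row_concat_def div_mod_less_of_less_mult)
qed

lemma row_concat_surj:
  assumes w: "w \<in> carrier_mat 1 (m * p)"
  obtains B where "B \<in> carrier_mat m p" and "row_concat B = w"
proof
  let ?B = "mat m p (\<lambda>(i, j). w $$ (0, i * p + j))"
  show "?B \<in> carrier_mat m p"
    by simp
  show "row_concat ?B = w"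
    using w by (intro eq_matI) (auto simp: row_concat_def div_mod_less_of_less_mult)
qed

text \<open>The matrix \<open>H\<close> represents the map sending \<open>B\<close> to \<open>AB - \<lambda>BA\<close> in row-major coordinates.\<close>

lemma row_concat_mult_twisted_commutator:
  fixes A B :: "'a :: comm_ring_1 mat"
  assumes A: "A \<in> carrier_mat n n" and B: "B \<in> carrier_mat n n"
  shows "row_concat B * (kronecker (transpose_mat A) (1\<^sub>m n) - lam \<cdot>\<^sub>m kronecker (1\<^sub>m n) A)
    = row_concat (A * B - lam \<cdot>\<^sub>m (B * A))"
proof -
  let ?K = "kronecker (transpose_mat A) (1\<^sub>m n)" and ?L = "kronecker (1\<^sub>m n) A"
  have K: "?K \<in> carrier_mat (n * n) (n * n)" and L: "?L \<in> carrier_mat (n * n) (n * n)"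
    using A by auto
  have b: "row_concat B \<in> carrier_mat 1 (n * n)"
    using row_concat_carrier [OF B] .
  have "row_concat B * ?K = row_concat (A * B)"
    using row_concat_mult_kronecker [OF B, of "transpose_mat A" n "1\<^sub>m n" n] A B by simp
  moreover have "row_concat B * ?L = row_concat (B * A)"
    using row_concat_mult_kronecker [OF B, of "1\<^sub>m n" n A n] A B by simp
  moreover have "row_concat B * (?K - lam \<cdot>\<^sub>m ?L) = row_concat B * ?K - lam \<cdot>\<^sub>m (row_concat B * ?L)"
    using mult_minus_distrib_mat [OF b K, of "lam \<cdot>\<^sub>m ?L"] mult_smult_distrib [OF b L, of lam] L
    by simp
  ultimately show ?thesis
    using row_concat_diff_smult [of "A * B" n n "B * A" lam] A B by simp
qed

theorem lemma3p2:
  fixes A :: "'a :: field mat" and lam :: 'a and n :: nat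
  assumes "A \<in> carrier_mat n n"
  shows "{row_concat B | B. B \<in> twisted_centralizer n A lam} =
    row_null_space (kronecker (transpose_mat A) (1\<^sub>m n) - lam \<cdot>\<^sub>m kronecker (1\<^sub>m n) A)"
proof -
  let ?H = "kronecker (transpose_mat A) (1\<^sub>m n) - lam \<cdot>\<^sub>m kronecker (1\<^sub>m n) A"
  have "kronecker (1\<^sub>m n) A \<in> carrier_mat (n * n) (n * n)"
    using assms by simp
  then have dim: "dim_row ?H = n * n" "dim_col ?H = n * n"
    by auto
  have kernel: "row_concat B * ?H = 0\<^sub>m 1 (n * n) \<longleftrightarrow> A * B - lam \<cdot>\<^sub>m (B * A) = 0\<^sub>m n n"
    if B: "B \<in> carrier_mat n n" for B
  proof -
    have "A * B - lam \<cdot>\<^sub>m (B * A) \<in> carrier_mat n n"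
      using assms B by auto
    then show ?thesis
      by (simp only: row_concat_mult_twisted_commutator [OF assms B] row_concat_eq_zero_iff)
  qed
  show ?thesis
  proof (intro equalityI subsetI)
    fix w
    assume "w \<in> {row_concat B | B. B \<in> twisted_centralizer n A lam}"
    then show "w \<in> row_null_space ?H"
      unfolding row_null_space_def dim twisted_centralizer_def
      using kernel row_concat_carrier [of _ n n] by auto
  next
    fix w
    assume "w \<in> row_null_space ?H"
    then have w: "w \<in> carrier_mat 1 (n * n)" and z: "w * ?H = 0\<^sub>m 1 (n * n)"
      unfolding row_null_space_def dim by auto
    obtain B where "B \<in> carrier_mat n n" and "row_concat B = w"
      using row_concat_surj [OF w] .
    then show "w \<in> {row_concat B | B. B \<in> twisted_centralizer n A lam}"
      unfolding twisted_centralizer_def using kernel z by auto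
  qed
qed

end
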